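(* For every $\beta\in(0,1)$ there exists a compact set $A_\beta\subset[0,1]$ with $\dim_P A_\beta=\beta$ with the following property: if $f\colon A_\beta\to\mathbb{R}^d$ is an $\alpha$-Hölder continuous function for some $d\in\mathbb{N}^+$ and $\alpha\in(0,1)$, then $$\dim_P f^*(A_\beta)\le \max\left\{\frac{\beta d}{\alpha d+\beta(1-\alpha d)},\ \beta(d+1-\alpha d)\right\}.$$
   Context: $\dim_P$ denotes packing dimension. $f^*(t)=(t,f(t))$, so $f^*(A_\beta)$ is the graph of $f$. $f$ is $\alpha$-Hölder continuous if there is $C<\infty$ with $|f(x)-f(y)|\le C|x-y|^\alpha$ for all $x,y\in A_\beta$. *)

theory Defs
  imports "HOL-Analysis.Analysis"
begin

definition packings :: "('a \<Rightarrow> 'a \<Rightarrow> real) \<Rightarrow> real \<Rightarrow> 'a set \<Rightarrow> ('a \<times> real) set set" where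
  "packings D \<delta> E = {P. finite P \<and> (\<forall>(x,r)\<in>P. x \<in> E \<and> 0 < r \<and> r \<le> \<delta>) \<and>
      pairwise (\<lambda>(x,r) (y,t). {z. D x z \<le> r} \<inter> {z. D y z \<le> t} = {}) P}"

definition packing_premeasure :: "('a \<Rightarrow> 'a \<Rightarrow> real) \<Rightarrow> real \<Rightarrow> 'a set \<Rightarrow> ennreal" where
  "packing_premeasure D s E =
     (INF \<delta>\<in>{0<..}. SUP P\<in>packings D \<delta> E. \<Sum>(x,r)\<in>P. ennreal ((2*r) powr s))"

definition packing_measure :: "('a \<Rightarrow> 'a \<Rightarrow> real) \<Rightarrow> real \<Rightarrow> 'a set \<Rightarrow> ennreal" where
  "packing_measure D s E =
     (INF Es\<in>{Es :: nat \<Rightarrow> 'a set. E \<subseteq> (\<Union>i. Es i)}. \<Sum>i. packing_premeasure D s (Es i))"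

definition packing_dim :: "('a \<Rightarrow> 'a \<Rightarrow> real) \<Rightarrow> 'a set \<Rightarrow> real" where
  "packing_dim D E = Inf {s. 0 \<le> s \<and> packing_measure D s E = 0}"

definition euclid_dist :: "nat \<Rightarrow> (nat \<Rightarrow> real) \<Rightarrow> (nat \<Rightarrow> real) \<Rightarrow> real" where
  "euclid_dist n x y = sqrt (\<Sum>i<n. (x i - y i)^2)"

definition graph_map :: "(real \<Rightarrow> nat \<Rightarrow> real) \<Rightarrow> real \<Rightarrow> nat \<Rightarrow> real" where
  "graph_map f t = (\<lambda>i. if i = 0 then t else f t (i - 1))"

definition holder_on :: "nat \<Rightarrow> real \<Rightarrow> real set \<Rightarrow> (real \<Rightarrow> nat \<Rightarrow> real) \<Rightarrow> bool" where
  "holder_on d \<alpha> A f \<longleftrightarrow> (\<exists>C. \<forall>x\<in>A. \<forall>y\<in>A. euclid_dist d (f x) (f y) \<le> C * \<bar>x - y\<bar> powr \<alpha>)"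

end

theory Submission
  imports Defs
begin

text \<open>Let \<open>A\<close> be the set of numbers whose binary digits vanish outside the blocks
  \<open>((1-\<beta>) n!, n!]\<close>, and let \<open>h(m)\<close> be the number of admissible positions up to \<open>m\<close>, so that \<open>2^h(m)\<close>
  dyadic intervals of length \<open>2^-m\<close> cover \<open>A\<close>. Since \<open>h(m) \<le> \<beta>m + o(m)\<close>, with equality up to \<open>o(m)\<close> at
  \<open>m = n!\<close>, the packing dimension of \<open>A\<close> is \<open>\<beta>\<close>; the lower bound uses Baire's theorem, because every
  relatively open piece of \<open>A\<close> has upper box dimension \<open>\<beta>\<close>.

  For \<open>y \<ge> k\<close> an \<open>\<alpha>\<close>-Hoelder graph over \<open>A\<close> is covered at scale \<open>2^-k\<close> by about
  \<open>2^(h(y) + d max(0, k - \<alpha>y))\<close> cubes. Let \<open>s\<close> be the claimed bound and \<open>X = n!\<close> be the block relevant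
  at scale \<open>k\<close>. If \<open>sk \<ge> \<beta>X\<close>, then \<open>y = k/\<alpha>\<close> gives exponent about \<open>\<beta>X \<le> sk\<close>. Otherwise choose \<open>y\<close> as the
  larger of \<open>k\<close> and the start \<open>(1-\<beta>)X\<close> of the block; since \<open>X > sk/\<beta>\<close>, the exponent is again at most
  about \<open>sk\<close>, by the first term of the maximum when \<open>k \<le> (1-\<beta>)X\<close> and by the second one otherwise.\<close>

section \<open>Upper bounds for packing dimension from counting labels\<close>

lemma packing_premeasure_empty: "packing_premeasure D s {} = 0"
proof -
  have "packings D \<delta> {} = {{}}" for \<delta>
    by (auto simp: packings_def)
  then show ?thesis by (simp add: packing_premeasure_def)
qed

lemma packing_premeasure_le:
  assumes "0 < \<delta>"
    and "\<And>P. P \<in> packings D \<delta> E \<Longrightarrow> (\<Sum>(x,r)\<in>P. ennreal ((2*r) powr s)) \<le> B"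
  shows "packing_premeasure D s E \<le> B"
  unfolding packing_premeasure_def
  by (rule INF_lower2[of \<delta>]) (use assms in \<open>auto intro: SUP_least\<close>)

lemma packing_measure_eq_0:
  assumes "packing_premeasure D s E = 0"
  shows "packing_measure D s E = 0"
proof -
  define Es where "Es = (\<lambda>i::nat. if i = 0 then E else {})"
  have "packing_measure D s E \<le> (\<Sum>i. packing_premeasure D s (Es i))"
    unfolding packing_measure_def by (rule INF_lower) (auto simp: Es_def)
  also have "packing_premeasure D s (Es i) = 0" for i
    using assms by (simp add: Es_def packing_premeasure_empty)
  then have "(\<Sum>i. packing_premeasure D s (Es i)) = 0" by simp
  finally show ?thesis by simp
qed

text \<open>Covering \<open>E\<close> by itself shows that a vanishing premeasure forces a vanishing
  measure, so upper bounds for the dimension never need a countable decomposition.\<close>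

lemma packing_dim_le:
  assumes "0 \<le> s" and "\<And>t. s < t \<Longrightarrow> packing_premeasure D t E = 0"
  shows "packing_dim D E \<le> s"
proof (rule field_le_epsilon)
  fix e :: real assume "0 < e"
  then have "packing_measure D (s+e) E = 0"
    by (intro packing_measure_eq_0 assms) simp
  then show "packing_dim D E \<le> s + e"
    unfolding packing_dim_def using \<open>0 < e\<close> \<open>0 \<le> s\<close>
    by (intro cInf_lower) (auto intro!: bdd_belowI[of _ 0])
qed

text \<open>Balls of radius above \<open>c/2^k\<close> centred at two points with the same label meet, so a packing
  contains at most one such ball per label.\<close>

lemma packing_premeasure_eq_0:
  fixes \<phi> :: "nat \<Rightarrow> 'a \<Rightarrow> 'b"
  assumes refl: "\<And>x. D x x = 0" and st: "s < t" "0 \<le> t" and "0 < c" "0 \<le> C"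
    and fin: "\<And>k. K \<le> k \<Longrightarrow> finite (\<phi> k ` E)"
    and card: "\<And>k. K \<le> k \<Longrightarrow> real (card (\<phi> k ` E)) \<le> C * 2 powr (s * k)"
    and sep: "\<And>k x y. K \<le> k \<Longrightarrow> x \<in> E \<Longrightarrow> y \<in> E \<Longrightarrow> \<phi> k x = \<phi> k y \<Longrightarrow> D x y \<le> c / 2^k"
  shows "packing_premeasure D t E = 0"
proof -
  \<comment> \<open>The balls of scale \<open>k\<close> will contribute at most
    \<open>C' * q ^ k\<close>, so a packing by balls of scale at least \<open>k0\<close> is
    controlled by a geometric tail.\<close>
  define q :: real where "q = 2 powr (s - t)"
  have q: "0 < q" "q < 1"
    using st by (auto simp: q_def powr_less_one)
  have q_pow: "q ^ k = 2 powr ((s - t) * k)" for k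
    by (simp add: q_def powr_powr flip: powr_realpow)
  define C' where "C' = C * (4*c) powr t"
  have "C' \<ge> 0" using \<open>0 \<le> C\<close> by (simp add: C'_def)
  have bound: "packing_premeasure D t E \<le> ennreal (C' * (q ^ k0 / (1 - q)))"
    if k0: "K \<le> k0" "1 \<le> k0" for k0
  proof (rule packing_premeasure_le)
    show "0 < 2 * c / 2 ^ k0" using \<open>0 < c\<close> by simp
    fix P assume P: "P \<in> packings D (2 * c / 2 ^ k0) E"
    then have "finite P" and PE: "\<And>x r. (x,r) \<in> P \<Longrightarrow> x \<in> E \<and> 0 < r \<and> r \<le> 2 * c / 2 ^ k0"
      and disj: "\<And>x r y u. (x,r) \<in> P \<Longrightarrow> (y,u) \<in> P \<Longrightarrow> (x,r) \<noteq> (y,u) \<Longrightarrow>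
         {z. D x z \<le> r} \<inter> {z. D y z \<le> u} = {}"
      by (fastforce simp: packings_def pairwise_def)+
    \<comment> \<open>The balls are sorted by scale: \<open>\<kappa>\<close> is the first
      \<open>k\<close> at which the radius exceeds \<open>c / 2^k\<close>, which pins the radius
      down up to a factor 2.\<close>
    define \<kappa> where "\<kappa> = (\<lambda>p::'a \<times> real. LEAST k. c / 2 ^ k < snd p)"
    have \<kappa>: "c / 2 ^ \<kappa> (x,r) < r \<and> r \<le> 2 * c / 2 ^ \<kappa> (x,r) \<and> k0 \<le> \<kappa> (x,r)"
      if "(x,r) \<in> P" for x r
    proof -
      have r: "0 < r" "r \<le> 2 * c / 2 ^ k0" using PE that by auto
      obtain k where "(1/2::real) ^ k < r / c"
        using real_arch_pow_inv[of "r/c" "1/2"] r \<open>0 < c\<close> by auto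
      then have "c / 2 ^ k < r"
        using \<open>0 < c\<close> by (simp add: field_simps power_one_over)
      then have 1: "c / 2 ^ \<kappa> (x,r) < r"
        unfolding \<kappa>_def by (auto intro: LeastI)
      have 2: "k0 \<le> \<kappa> (x,r)"
      proof (rule ccontr)
        assume "\<not> k0 \<le> \<kappa> (x,r)"
        then have "(2::real) ^ Suc (\<kappa> (x,r)) \<le> 2 ^ k0" by (intro power_increasing) auto
        then have "2 * c / 2 ^ k0 \<le> 2 * c / 2 ^ Suc (\<kappa> (x,r))"
          using \<open>0 < c\<close> by (intro divide_left_mono) auto
        then show False using 1 r by simp
      qed
      \<comment> \<open>Since \<open>1 \<le> k0\<close>, the scale has a predecessor
        \<open>j\<close>; minimality there gives the upper bound on the radius.\<close>
      then obtain j where j: "\<kappa> (x,r) = Suc j" using k0 by (cases "\<kappa> (x,r)") auto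
      then have "\<not> c / 2 ^ j < r"
        using not_less_Least[of j "\<lambda>k. c / 2 ^ k < snd (x,r)"] by (simp add: \<kappa>_def)
      then show ?thesis using 1 2 j by simp
    qed
    have group: "(\<Sum>(x,r)\<in>{p\<in>P. \<kappa> p = k}. (2*r) powr t) \<le> C' * q ^ k"
      if k: "k \<in> \<kappa> ` P" for k
    proof -
      have "K \<le> k" using \<kappa> k k0 by fastforce
      have inj: "inj_on (\<phi> k \<circ> fst) {p\<in>P. \<kappa> p = k}"
      proof (rule inj_onI)
        fix p p' assume p: "p \<in> {p\<in>P. \<kappa> p = k}" "p' \<in> {p\<in>P. \<kappa> p = k}" "(\<phi> k \<circ> fst) p = (\<phi> k \<circ> fst) p'"
        obtain x r y u where xy: "p = (x,r)" "p' = (y,u)" by (metis surj_pair)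
        have *: "(x,r) \<in> P" "(y,u) \<in> P" "\<phi> k x = \<phi> k y" "\<kappa> (x,r) = k" "\<kappa> (y,u) = k"
          using p by (simp_all add: xy)
        have "D x y \<le> c / 2 ^ k" using sep[OF \<open>K \<le> k\<close>, of x y] PE * by auto
        \<comment> \<open>The centre \<open>y\<close> is a common point of the two balls.\<close>
        then have "D x y \<le> r" "D y y \<le> u" using \<kappa>[of x r] * PE[of y u] refl by auto
        then show "p = p'" using disj[of x r y u] * xy by auto
      qed
      have "card {p\<in>P. \<kappa> p = k} = card ((\<phi> k \<circ> fst) ` {p\<in>P. \<kappa> p = k})"
        by (rule card_image[OF inj, symmetric])
      also have "\<dots> \<le> card (\<phi> k ` E)"
        using PE by (intro card_mono fin \<open>K \<le> k\<close>) auto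
      finally have "real (card {p\<in>P. \<kappa> p = k}) \<le> C * 2 powr (s * k)"
        using card[OF \<open>K \<le> k\<close>] by linarith
      moreover have "(\<Sum>(x,r)\<in>{p\<in>P. \<kappa> p = k}. (2*r) powr t)
          \<le> real (card {p\<in>P. \<kappa> p = k}) * (4 * c / 2 ^ k) powr t"
      proof (rule sum_bounded_above, clarsimp)
        fix x r assume "(x,r) \<in> P" "k = \<kappa> (x,r)"
        then show "(2*r) powr t \<le> (4 * c / 2 ^ \<kappa> (x,r)) powr t"
          using \<kappa>[of x r] PE[of x r] st by (intro powr_mono2) auto
      qed
      ultimately have "(\<Sum>(x,r)\<in>{p\<in>P. \<kappa> p = k}. (2*r) powr t)
          \<le> C * 2 powr (s * k) * (4 * c / 2 ^ k) powr t"
        by (meson mult_right_mono order_trans powr_ge_zero)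
      also have "(4 * c / 2 ^ k) powr t = (4*c) powr t * 2 powr (- t * k)"
        using \<open>0 < c\<close>
        by (simp add: powr_divide powr_minus_divide powr_powr mult.commute flip: powr_realpow)
      also have "C * 2 powr (s * k) * ((4*c) powr t * 2 powr (- t * k)) = C' * q ^ k"
        by (simp add: C'_def q_pow algebra_simps flip: powr_add)
      finally show ?thesis .
    qed
    have "(\<Sum>(x,r)\<in>P. (2*r) powr t) = (\<Sum>k\<in>\<kappa>`P. \<Sum>(x,r)\<in>{p\<in>P. \<kappa> p = k}. (2*r) powr t)"
      using \<open>finite P\<close> by (simp add: sum.image_gen)
    also have "\<dots> \<le> (\<Sum>k\<in>\<kappa>`P. C' * q ^ k)"
      by (intro sum_mono group)
    also have "\<dots> = C' * (\<Sum>k\<in>\<kappa>`P. q ^ k)" by (simp add: sum_distrib_left)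
    also have "(\<Sum>k\<in>\<kappa>`P. q ^ k) \<le> q ^ k0 / (1 - q)"
    proof -
      have ge: "k0 \<le> k" if "k \<in> \<kappa>`P" for k using \<kappa> that by force
      have "(\<Sum>k\<in>\<kappa>`P. q ^ k) = (\<Sum>j\<in>(\<lambda>k. k - k0)`\<kappa>`P. q ^ (j + k0))"
        using ge
        by (intro sum.reindex_bij_witness[of _ "\<lambda>j. j + k0" "\<lambda>k. k - k0"]) auto
      also have "\<dots> = q ^ k0 * (\<Sum>j\<in>(\<lambda>k. k - k0)`\<kappa>`P. q ^ j)"
        by (simp add: power_add sum_distrib_left mult.commute)
      also have "(\<Sum>j\<in>(\<lambda>k. k - k0)`\<kappa>`P. q ^ j) \<le> (\<Sum>j. q ^ j)"
        using q \<open>finite P\<close> by (intro sum_le_suminf summable_geometric) auto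
      also have "(\<Sum>j. q ^ j) = 1 / (1 - q)"
        using q by (simp add: suminf_geometric)
      finally show ?thesis using q by (simp add: mult_left_mono)
    qed
    finally have "(\<Sum>(x,r)\<in>P. (2*r) powr t) \<le> C' * (q ^ k0 / (1 - q))"
      using \<open>C' \<ge> 0\<close> by (simp add: mult_left_mono)
    then show "(\<Sum>(x,r)\<in>P. ennreal ((2*r) powr t)) \<le> ennreal (C' * (q ^ k0 / (1 - q)))"
      by (simp add: case_prod_unfold sum_ennreal ennreal_leI)
  qed
  \<comment> \<open>Letting \<open>k0\<close> tend to infinity makes the tail vanish.\<close>
  have "(\<lambda>k0. ennreal (C' * (q ^ k0 / (1 - q)))) \<longlonglongrightarrow> ennreal (C' * (0 / (1 - q)))"
    using q by (intro tendsto_intros LIMSEQ_power_zero) auto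
  then have "packing_premeasure D t E \<le> ennreal (C' * (0 / (1 - q)))"
    using bound by (intro LIMSEQ_le_const[of _ _ "packing_premeasure D t E"]) (auto intro!: exI[of _ "max K 1"])
  then show ?thesis by simp
qed

section \<open>Sets defined by restricting binary digits\<close>

text \<open>At level \<open>m\<close> the number \<open>i\<close> stands for the dyadic interval \<open>[i/2^m, (i+1)/2^m]\<close>; the digit at
  position \<open>m+1\<close> selects one of its halves.\<close>

primrec descendants :: "nat set \<Rightarrow> nat \<Rightarrow> nat set \<Rightarrow> nat \<Rightarrow> nat set" where
  "descendants S m X 0 = X"
| "descendants S m X (Suc n) = (\<lambda>i. 2*i) ` descendants S m X n \<union>
     (if Suc (m+n) \<in> S then (\<lambda>i. Suc (2*i)) ` descendants S m X n else {})"

lemma finite_descendants: "finite X \<Longrightarrow> finite (descendants S m X n)"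
  by (induction n) auto

text \<open>Left children are even and right children odd, so they never coincide: each position in
  \<open>S\<close> doubles the count and every other position preserves it.\<close>

lemma card_descendants:
  assumes "finite X"
  shows "card (descendants S m X n) = card X * 2 ^ card (S \<inter> {m<..m+n})"
proof (induction n)
  case (Suc n)
  have *: "S \<inter> {m<..m + Suc n} = (if Suc (m+n) \<in> S then insert (Suc (m+n)) (S \<inter> {m<..m+n}) else S \<inter> {m<..m+n})"
    by (auto simp: le_Suc_eq)
  have c: "card ((\<lambda>i. 2*i) ` descendants S m X n) = card (descendants S m X n)"
    "card ((\<lambda>i. Suc (2*i)) ` descendants S m X n) = card (descendants S m X n)"
    by (auto intro!: card_image inj_onI)
  have "(\<lambda>i. 2*i) ` descendants S m X n \<inter> (\<lambda>i. Suc (2*i)) ` descendants S m X n = {}"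
    by auto presburger
  then show ?case
    using Suc assms c
    by (cases "Suc (m+n) \<in> S")
      (simp_all add: * card_Un_disjoint finite_descendants del: add_Suc_right)
qed simp

lemma descendants_mono: "X \<subseteq> Y \<Longrightarrow> descendants S m X n \<subseteq> descendants S m Y n"
  by (induction n) auto

lemma descendants_add:
  "descendants S l X (m+n) = descendants S (l+m) (descendants S l X m) n"
  by (induction n) (auto simp: add.assoc)

text \<open>Dividing by \<open>2^n\<close> deletes the last \<open>n\<close> binary digits and thus
  recovers the ancestor.\<close>

lemma descendants_div: "i \<in> descendants S m X n \<Longrightarrow> i div 2^n \<in> X"
proof (induction n arbitrary: i)
  case (Suc n)
  then have "i div 2 \<in> descendants S m X n" by (auto split: if_splits)
  then have "i div 2 div 2^n \<in> X" by (rule Suc.IH)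
  then show ?case by (simp add: div_mult2_eq)
qed auto

text \<open>The digit 0 is admissible at every position, so zeros can always be appended.\<close>

lemma descendants_mult: "i \<in> X \<Longrightarrow> i * 2^n \<in> descendants S m X n"
  by (induction n) (auto simp: image_iff)

text \<open>The numbers in \<open>[0,1]\<close> having a binary expansion all of whose nonzero digits are at positions in \<open>S\<close>.\<close>

definition digit_set :: "nat set \<Rightarrow> real set" where
  "digit_set S = {x. \<forall>m. \<exists>i\<in>descendants S 0 {0} m. real i \<le> 2^m * x \<and> 2^m * x \<le> real i + 1}"

lemma digit_set_subset: "digit_set S \<subseteq> {0..1}"
  by (auto simp: digit_set_def dest!: spec[of _ 0])

text \<open>Each level imposes membership in a finite union of closed intervals.\<close>

lemma compact_digit_set: "compact (digit_set S)"
proof -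
  have "digit_set S = (\<Inter>m. \<Union>i\<in>descendants S 0 {0} m. {x. real i \<le> 2^m * x} \<inter> {x. 2^m * x \<le> real i + 1})"
    by (auto simp: digit_set_def)
  also have "closed \<dots>"
    by (intro closed_INT ballI closed_UN finite_descendants closed_Int closed_Collect_le continuous_intros) auto
  finally show ?thesis
    using digit_set_subset[of S] by (meson bounded_closed_interval bounded_subset compact_eq_bounded_closed)
qed

lemma div_bounds:
  fixes i n :: nat
  shows "real (i div n) \<le> real i / real n" "real i / real n \<le> real (i div n) + 1"
proof -
  have "real (i div n) = of_int \<lfloor>real i / real n\<rfloor>"
    by (simp add: floor_divide_of_nat_eq)
  then show "real (i div n) \<le> real i / real n" "real i / real n \<le> real (i div n) + 1"
    by linarith+
qed

text \<open>The left end of an admissible interval stays admissible at finer levels by appending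
  zeros and at coarser levels by truncating digits.\<close>

lemma dyadic_in_digit_set:
  assumes i: "i \<in> descendants S 0 {0} m"
  shows "real i / 2^m \<in> digit_set S"
  unfolding digit_set_def
proof safe
  fix n
  show "\<exists>j\<in>descendants S 0 {0} n. real j \<le> 2^n * (real i / 2^m) \<and> 2^n * (real i / 2^m) \<le> real j + 1"
  proof (cases "m \<le> n")
    case True
    then obtain l where l: "n = m + l" using le_Suc_ex by blast
    then have "i * 2^l \<in> descendants S 0 {0} n"
      using descendants_mult[OF i] by (simp add: descendants_add)
    then show ?thesis
      by (intro bexI[of _ "i * 2^l"]) (auto simp: l power_add)
  next
    case False
    then obtain l where l: "m = n + l" using le_Suc_ex nat_le_linear by blast
    then have "i div 2^l \<in> descendants S 0 {0} n"
      using descendants_div i by (simp add: descendants_add)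
    moreover have "2^n * (real i / 2^m) = real i / real (2^l)"
      by (simp add: l power_add)
    moreover have "real (i div 2^l) \<le> real i / real (2^l)" "real i / real (2^l) \<le> real (i div 2^l) + 1"
      using div_bounds by blast+
    ultimately show ?thesis by metis
  qed
qed

lemma digit_set_labels:
  obtains \<phi> :: "real \<Rightarrow> nat" where "finite (\<phi> ` digit_set S)"
    and "card (\<phi> ` digit_set S) \<le> 2 ^ card (S \<inter> {0<..m})"
    and "\<And>x y. x \<in> digit_set S \<Longrightarrow> y \<in> digit_set S \<Longrightarrow> \<phi> x = \<phi> y \<Longrightarrow> \<bar>x - y\<bar> \<le> 1 / 2^m"
proof -
  \<comment> \<open>At an interval endpoint the floor of \<open>2^m * x\<close> need not be
    admissible, so the label is chosen among the admissible intervals that contain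
    \<open>x\<close>.\<close>
  have "\<forall>x\<in>digit_set S. \<exists>i. i \<in> descendants S 0 {0} m \<and> real i \<le> 2^m * x \<and> 2^m * x \<le> real i + 1"
    by (auto simp: digit_set_def)
  then obtain \<phi> where \<phi>: "\<And>x. x \<in> digit_set S \<Longrightarrow>
      \<phi> x \<in> descendants S 0 {0} m \<and> real (\<phi> x) \<le> 2^m * x \<and> 2^m * x \<le> real (\<phi> x) + 1"
    by metis
  have sub: "\<phi> ` digit_set S \<subseteq> descendants S 0 {0} m" using \<phi> by auto
  have fin: "finite (descendants S 0 {0} m)" by (simp add: finite_descendants)
  show ?thesis
  proof (rule that[of \<phi>])
    show "finite (\<phi> ` digit_set S)" using sub fin finite_subset by blast
    show "card (\<phi> ` digit_set S) \<le> 2 ^ card (S \<inter> {0<..m})"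
      using card_mono[OF fin sub] by (simp add: card_descendants)
    fix x y assume "x \<in> digit_set S" "y \<in> digit_set S" "\<phi> x = \<phi> y"
    then have "\<bar>2^m * x - 2^m * y\<bar> \<le> 1" using \<phi>[of x] \<phi>[of y] by auto
    then have "2^m * \<bar>x - y\<bar> \<le> 1"
      by (simp add: abs_mult flip: right_diff_distrib)
    then show "\<bar>x - y\<bar> \<le> 1 / 2^m" by (simp add: field_simps)
  qed
qed


section \<open>Lower bounds for packing measure by Baire category\<close>

text \<open>By Baire's theorem, some member of any countable cover of \<open>A\<close> is dense in a
  relatively open piece of \<open>A\<close>. A lower bound for the premeasure of all such members
  therefore passes to the measure.\<close>

lemma packing_measure_ge_1:
  fixes A :: "'a::{real_normed_vector,heine_borel} set"
  assumes "closed A" "A \<noteq> {}"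
    and dense: "\<And>a e E. a \<in> A \<Longrightarrow> 0 < e \<Longrightarrow> A \<inter> ball a e \<subseteq> closure E \<Longrightarrow> 1 \<le> packing_premeasure D s E"
  shows "1 \<le> packing_measure D s A"
  unfolding packing_measure_def
proof (rule INF_greatest, clarify)
  fix Es :: "nat \<Rightarrow> 'a set" assume cover: "A \<subseteq> (\<Union>i. Es i)"
  have "\<exists>i. 1 \<le> packing_premeasure D s (Es i)"
  proof (rule ccontr)
    assume small: "\<nexists>i. 1 \<le> packing_premeasure D s (Es i)"
    have "A \<subseteq> closure (\<Inter>(range (\<lambda>i. A - closure (Es i))))"
    proof (rule Baire[OF \<open>closed A\<close>])
      fix T assume "T \<in> range (\<lambda>i. A - closure (Es i))"
      then obtain i where T: "T = A - closure (Es i)" by auto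
      have "openin (top_of_set A) T"
        unfolding T using openin_open_Int[of "- closure (Es i)" A] by (simp add: Diff_eq open_Compl)
      moreover have "A \<subseteq> closure T"
      proof
        fix a assume "a \<in> A"
        show "a \<in> closure T"
        proof (rule ccontr)
          assume "a \<notin> closure T"
          then obtain e where "0 < e" "\<forall>y\<in>T. \<not> dist y a < e"
            by (auto simp: closure_approachable)
          \<comment> \<open>A ball around \<open>a\<close> that misses \<open>T\<close> meets
            \<open>A\<close> only inside \<open>closure (Es i)\<close>, which is the situation
            excluded by \<open>dense\<close> and \<open>small\<close>.\<close>
          then have "A \<inter> ball a e \<subseteq> closure (Es i)"
            by (auto simp: T dist_commute)
          then show False using dense \<open>a \<in> A\<close> \<open>0 < e\<close> small by blast
        qed
      qed
      ultimately show "openin (top_of_set A) T \<and> A \<subseteq> closure T" ..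
    qed auto
    moreover have "x \<notin> \<Inter>(range (\<lambda>i. A - closure (Es i)))" for x
    proof
      assume x: "x \<in> \<Inter>(range (\<lambda>i. A - closure (Es i)))"
      then have "x \<in> A" by simp
      then obtain i where "x \<in> Es i" using cover by blast
      then have "x \<in> closure (Es i)" using closure_subset by blast
      then show False using x by simp
    qed
    then have "\<Inter>(range (\<lambda>i. A - closure (Es i))) = {}" by blast
    ultimately show False using \<open>A \<noteq> {}\<close> by (metis closure_empty subset_empty)
  qed
  then obtain i where "1 \<le> packing_premeasure D s (Es i)" ..
  also have "\<dots> \<le> (\<Sum>i. packing_premeasure D s (Es i))"
    using sum_le_suminf[of "\<lambda>i. packing_premeasure D s (Es i)" "{i}"] by simp
  finally show "1 \<le> (\<Sum>i. packing_premeasure D s (Es i))" .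
qed

text \<open>Inside a short level-\<open>m\<close> interval near \<open>a\<close>, the left ends of
  its level-\<open>n\<close> descendants are \<open>2^-n\<close> apart. Points of \<open>E\<close>
  close to them are centres of a packing by balls of radius comparable to \<open>2^-n\<close>, and
  \<open>digits\<close> makes these numerous enough for the sum to reach 1.\<close>

lemma digit_set_premeasure_ge_1:
  assumes a: "a \<in> digit_set S" and "0 < e" and dense: "digit_set S \<inter> ball a e \<subseteq> closure E"
    and digits: "\<And>m. \<exists>n\<ge>m. s * (real n + 1) \<le> card (S \<inter> {m<..n})"
  shows "1 \<le> packing_premeasure dist s E"
  unfolding packing_premeasure_def
proof (rule INF_greatest)
  fix \<delta> :: real assume "\<delta> \<in> {0<..}"
  \<comment> \<open>This \<open>m\<close> puts the level-\<open>m\<close> interval inside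
    \<open>ball a e\<close> and also keeps the radius below \<open>\<delta>\<close>.\<close>
  then obtain m where m: "(1/2::real) ^ m < min e \<delta>"
    using real_arch_pow_inv[of "min e \<delta>" "1/2"] \<open>0 < e\<close> by auto
  obtain i where i: "i \<in> descendants S 0 {0} m" "real i \<le> 2^m * a" "2^m * a \<le> real i + 1"
    using a by (auto simp: digit_set_def)
  obtain n where n: "m \<le> n" "s * (real n + 1) \<le> card (S \<inter> {m<..n})"
    using digits by blast
  obtain l where l: "n = m + l" using n le_Suc_ex by blast
  define T where "T = descendants S m {i} l"
  have "finite T" by (simp add: T_def finite_descendants)
  have card_T: "card T = 2 ^ card (S \<inter> {m<..n})"
    by (simp add: T_def card_descendants l)
  \<comment> \<open>The left ends lie only in the closure of \<open>E\<close>, while centres must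
    lie in \<open>E\<close>; hence the approximation.\<close>
  have "\<exists>y\<in>E. dist y (real j / 2^n) < 1 / (8 * 2^n)" if "j \<in> T" for j
  proof -
    have "j \<in> descendants S 0 {0} n"
      using descendants_mono[of "{i}" "descendants S 0 {0} m" S m l] that i
      by (auto simp: l descendants_add T_def)
    then have "real j / 2^n \<in> digit_set S" by (rule dyadic_in_digit_set)
    moreover have "real j / 2^n \<in> ball a e"
    proof -
      have "i = j div 2^l" using descendants_div[of j S m "{i}" l] that by (auto simp: T_def)
      then have "real i \<le> real j / 2^l" "real j / 2^l \<le> real i + 1"
        using div_bounds[of j "2^l"] by auto
      then have "\<bar>2^m * a - real j / 2^l\<bar> \<le> 1" using i by auto
      also have "2^m * a - real j / 2^l = 2^m * (a - real j / 2^n)"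
        by (simp add: l power_add right_diff_distrib)
      finally have "2^m * \<bar>a - real j / 2^n\<bar> \<le> 1"
        by (simp only: abs_mult) simp
      then have "\<bar>a - real j / 2^n\<bar> \<le> 1 / 2^m"
        by (subst pos_le_divide_eq) (simp_all add: mult.commute)
      then have "\<bar>a - real j / 2^n\<bar> \<le> (1/2)^m" by (simp add: power_one_over)
      then show ?thesis using m by (simp add: dist_real_def)
    qed
    ultimately have "real j / 2^n \<in> closure E" using dense by blast
    then show ?thesis unfolding closure_approachable by simp
  qed
  then obtain g where g: "\<And>j. j \<in> T \<Longrightarrow> g j \<in> E \<and> dist (g j) (real j / 2^n) < 1 / (8 * 2^n)"
    by metis
  \<comment> \<open>Two radii and two approximation errors add up to \<open>3/4\<close> of the
    spacing \<open>1 / 2^n\<close>, so the balls stay disjoint.\<close>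
  define r :: real where "r = 1 / (4 * 2^n)"
  have "0 < r" by (simp add: r_def)
  have "r \<le> (1/2)^m"
  proof -
    have "(2::real)^m \<le> 4 * 2^n"
      using power_increasing[OF n(1), of "2::real"]
      by (rule order_trans) simp_all
    then show ?thesis by (simp add: r_def power_one_over field_simps)
  qed
  then have "r \<le> \<delta>" using m by linarith
  have sep: "j = k" if "j \<in> T" "k \<in> T" "dist (g j) z \<le> r" "dist (g k) z \<le> r" for j k z
  proof -
    have "\<bar>real j / 2^n - real k / 2^n\<bar> < 2 * r + 2 * (1 / (8 * 2^n))"
      using that g[of j] g[of k] by (auto simp: dist_real_def)
    also have "\<dots> = (3/4) / 2^n" by (simp add: r_def field_simps)
    also have "real j / 2^n - real k / 2^n = (real j - real k) / 2^n" by (simp add: diff_divide_distrib)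
    finally have "2^n * \<bar>(real j - real k) / 2^n\<bar> < 2^n * ((3/4) / 2^n)"
      by (intro mult_strict_left_mono) auto
    then have "\<bar>real j - real k\<bar> < 3/4" by simp
    then show ?thesis by linarith
  qed
  have inj: "inj_on (\<lambda>j. (g j, r)) T"
  proof (rule inj_onI)
    fix j k assume "j \<in> T" "k \<in> T" "(g j, r) = (g k, r)"
    then show "j = k" using sep[of j k "g j"] \<open>0 < r\<close> by simp
  qed
  have P: "(\<lambda>j. (g j, r)) ` T \<in> packings dist \<delta> E"
    unfolding packings_def
  proof (intro CollectI conjI)
    show "pairwise (\<lambda>(x,r) (y,t). {z. dist x z \<le> r} \<inter> {z. dist y z \<le> t} = {}) ((\<lambda>j. (g j, r)) ` T)"
    proof (rule pairwiseI)
      fix p q assume "p \<in> (\<lambda>j. (g j, r)) ` T" "q \<in> (\<lambda>j. (g j, r)) ` T" "p \<noteq> q"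
      then obtain j k where "j \<in> T" "k \<in> T" "p = (g j, r)" "q = (g k, r)" "j \<noteq> k" by auto
      then show "(case p of (x,r) \<Rightarrow> \<lambda>(y,t). {z. dist x z \<le> r} \<inter> {z. dist y z \<le> t} = {}) q"
        using sep by auto
    qed
  qed (use \<open>finite T\<close> \<open>0 < r\<close> \<open>r \<le> \<delta>\<close> g in auto)
  \<comment> \<open>The diameter is \<open>2^-(n+1)\<close>, whence the \<open>n + 1\<close> in the
    hypothesis \<open>digits\<close>.\<close>
  have "(2 * r) powr s = 2 powr (- (s * (real n + 1)))"
  proof -
    have "2 * r = 1 / 2 ^ Suc n" by (simp add: r_def)
    also have "\<dots> = 2 powr (- (real n + 1))"
      unfolding powr_minus_divide by (simp add: powr_add powr_realpow)
    finally show ?thesis by (metis powr_powr mult.commute mult_minus_right)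
  qed
  then have "real (card T) * (2 * r) powr s = 2 powr (real (card (S \<inter> {m<..n})) - s * (real n + 1))"
    by (simp add: card_T powr_diff powr_minus_divide powr_realpow)
  also have "\<dots> \<ge> 1" using n by (intro ge_one_powr_ge_zero) auto
  finally have "1 \<le> ennreal (real (card T) * (2 * r) powr s)"
    by simp
  also have "\<dots> = (\<Sum>(x,r)\<in>(\<lambda>j. (g j, r)) ` T. ennreal ((2 * r) powr s))"
    by (simp add: sum.reindex[OF inj] ennreal_mult ennreal_of_nat_eq_real_of_nat)
  also have "\<dots> \<le> (SUP P\<in>packings dist \<delta> E. \<Sum>(x,r)\<in>P. ennreal ((2 * r) powr s))"
    by (rule SUP_upper[OF P])
  finally show "1 \<le> (SUP P\<in>packings dist \<delta> E. \<Sum>(x,r)\<in>P. ennreal ((2 * r) powr s))" .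
qed

section \<open>The factorial blocks of free digits\<close>

definition block_start :: "real \<Rightarrow> nat \<Rightarrow> nat" where
  "block_start \<beta> n = nat \<lfloor>(1 - \<beta>) * fact n\<rfloor>"

text \<open>Factorials grow so fast that all positions up to \<open>fact n\<close> are negligible
  against the start of block \<open>n+1\<close>: the ratio is about
  \<open>1 / ((1 - \<beta>) * (n+1))\<close>.\<close>

definition block_set :: "real \<Rightarrow> nat set" where
  "block_set \<beta> = (\<Union>n. {block_start \<beta> n<..fact n})"

context
  fixes \<beta> :: real
  assumes \<beta>: "0 < \<beta>" "\<beta> < 1"
begin

lemma block_start_bounds:
  "real (block_start \<beta> n) \<le> (1 - \<beta>) * fact n" "(1 - \<beta>) * fact n \<le> real (block_start \<beta> n) + 1"
proof -
  have "0 \<le> (1 - \<beta>) * fact n" using \<beta> by simp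
  then show "real (block_start \<beta> n) \<le> (1 - \<beta>) * fact n"
    "(1 - \<beta>) * fact n \<le> real (block_start \<beta> n) + 1"
    unfolding block_start_def by linarith+
qed

lemma block_start_mono: "m \<le> n \<Longrightarrow> block_start \<beta> m \<le> block_start \<beta> n"
  unfolding block_start_def using \<beta>
  by (intro nat_mono floor_mono mult_left_mono fact_mono) auto

lemma block_start_le_fact: "block_start \<beta> n \<le> fact n"
proof -
  have "real (block_start \<beta> n) \<le> 1 * fact n"
    using block_start_bounds(1)[of n] \<beta> by (elim order_trans) (intro mult_right_mono, auto)
  then show ?thesis by (metis mult_1 of_nat_fact of_nat_le_iff)
qed

text \<open>Everything up to \<open>fact n\<close> is counted as admissible, block
  \<open>n+1\<close> contributes its part below \<open>m\<close>, and block \<open>n+2\<close> has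
  not begun.\<close>

lemma card_block_set_le:
  assumes "m \<le> block_start \<beta> (n+2)"
  shows "card (block_set \<beta> \<inter> {0<..m}) \<le> fact n + (min (fact (n+1)) m - block_start \<beta> (n+1))"
proof -
  have "block_set \<beta> \<inter> {0<..m} \<subseteq> {0<..fact n} \<union> {block_start \<beta> (n+1)<..min (fact (n+1)) m}"
  proof
    fix k assume "k \<in> block_set \<beta> \<inter> {0<..m}"
    then obtain j where j: "block_start \<beta> j < k" "k \<le> fact j" "0 < k" "k \<le> m"
      by (auto simp: block_set_def)
    have "\<not> n + 2 \<le> j" using block_start_mono[of "n+2" j] j assms by linarith
    then consider "j \<le> n" | "j = n+1" by linarith
    then show "k \<in> {0<..fact n} \<union> {block_start \<beta> (n+1)<..min (fact (n+1)) m}"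
    proof cases
      case 1
      then have "(fact j :: nat) \<le> fact n" by (rule fact_mono)
      then show ?thesis using j by auto
    qed (use j in auto)
  qed
  then have "card (block_set \<beta> \<inter> {0<..m}) \<le> card ({0<..fact n} \<union> {block_start \<beta> (n+1)<..min (fact (n+1)) m})"
    by (intro card_mono) auto
  also have "\<dots> \<le> card {0<..fact n::nat} + card {block_start \<beta> (n+1)<..min (fact (n+1)) m}"
    by (rule card_Un_le)
  finally show ?thesis by simp
qed

text \<open>Block \<open>n\<close> alone suffices, because its start is rounded down.\<close>

lemma card_block_set_ge:
  assumes "m \<le> block_start \<beta> n"
  shows "\<beta> * fact n \<le> card (block_set \<beta> \<inter> {m<..fact n})"
proof -
  have "{block_start \<beta> n<..fact n} \<subseteq> block_set \<beta> \<inter> {m<..fact n}"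
    using assms by (auto simp: block_set_def)
  then have "card {block_start \<beta> n<..fact n} \<le> card (block_set \<beta> \<inter> {m<..fact n})"
    by (intro card_mono) auto
  then have "fact n \<le> block_start \<beta> n + card (block_set \<beta> \<inter> {m<..fact n})"
    by simp
  then have "fact n \<le> real (block_start \<beta> n) + card (block_set \<beta> \<inter> {m<..fact n})"
    by (metis of_nat_add of_nat_fact of_nat_le_iff)
  then show ?thesis using block_start_bounds(1)[of n] by (simp add: algebra_simps)
qed

lemma block_start_unbounded: "\<exists>n\<ge>n0. c \<le> real (block_start \<beta> n)"
proof -
  define n where "n = max n0 (nat \<lceil>(c + 1) / (1 - \<beta>)\<rceil>)"
  have "(c + 1) / (1 - \<beta>) \<le> n" unfolding n_def by linarith
  also have "real n \<le> fact n" by (metis fact_ge_self of_nat_fact of_nat_le_iff)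
  finally have "c + 1 \<le> (1 - \<beta>) * fact n" using \<beta> by (simp add: field_simps)
  then show ?thesis
    using block_start_bounds(2)[of n] by (intro exI[of _ n]) (auto simp: n_def)
qed

text \<open>Block \<open>n+2\<close> is the first whose start, scaled by \<open>\<alpha>\<close>,
  reaches \<open>k\<close>. Thus even position \<open>k / \<alpha>\<close> precedes that block,
  while \<open>k\<close> exceeds the scaled start of block \<open>n+1\<close>, which dwarfs
  \<open>fact n\<close> and any constant \<open>B\<close> collecting rounding errors.\<close>

lemma block_scale:
  fixes \<alpha> \<epsilon> B :: real
  assumes "0 < \<alpha>" "0 < \<epsilon>" "0 \<le> B"
  shows "\<exists>K::nat. \<forall>k::nat. K \<le> k \<longrightarrow> (\<exists>n. \<alpha> * block_start \<beta> (n+1) < real k \<and> real k \<le> \<alpha> * block_start \<beta> (n+2) \<and>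
           fact n + B \<le> \<epsilon> * k)"
proof -
  define e where "e = \<epsilon> * \<alpha>"
  have "0 < e" using assms by (simp add: e_def)
  \<comment> \<open>The numerator pays for \<open>fact n\<close>, for \<open>B\<close> and for the
    rounding error of \<open>block_start\<close>; the latter two are constants and are bounded by
    multiples of \<open>fact n\<close>.\<close>
  define n0 where "n0 = nat \<lceil>(1 + B + e) / (e * (1 - \<beta>))\<rceil>"
  have small: "fact n + B \<le> e * block_start \<beta> (n+1)" if "n0 \<le> n" for n
  proof -
    have "(1 + B + e) / (e * (1 - \<beta>)) \<le> real n + 1" using that unfolding n0_def by linarith
    then have "1 + B + e \<le> (real n + 1) * (e * (1 - \<beta>))"
      using \<open>0 < e\<close> \<beta> by (simp add: pos_divide_le_eq)
    then have "(1 + B + e) * fact n \<le> (real n + 1) * (e * (1 - \<beta>)) * fact n"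
      by (intro mult_right_mono) auto
    also have "\<dots> = e * ((1 - \<beta>) * fact (n+1))" by (simp add: algebra_simps)
    also have "\<dots> \<le> e * (block_start \<beta> (n+1) + 1)"
      using block_start_bounds(2)[of "n+1"] \<open>0 < e\<close> by (intro mult_left_mono) auto
    finally have "(1 + B + e) * fact n \<le> e * (block_start \<beta> (n+1) + 1)" .
    moreover have "(B + e) * 1 \<le> (B + e) * fact n"
      using assms \<open>0 < e\<close> by (intro mult_left_mono) auto
    ultimately show ?thesis by (simp add: algebra_simps)
  qed
  show ?thesis
  proof (rule exI, intro allI impI)
    fix k :: nat assume "nat \<lceil>\<alpha> * block_start \<beta> (n0+1)\<rceil> + 1 \<le> k"
    then have k: "\<alpha> * block_start \<beta> (n0+1) < k" by linarith
    define N where "N = (LEAST N. k \<le> \<alpha> * block_start \<beta> N)"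
    obtain N0 where "k / \<alpha> \<le> block_start \<beta> N0" using block_start_unbounded by blast
    then have "k \<le> \<alpha> * block_start \<beta> N0" using assms by (simp add: field_simps)
    then have N: "k \<le> \<alpha> * block_start \<beta> N" unfolding N_def by (rule LeastI)
    have "n0 + 1 < N"
    proof (rule ccontr)
      assume "\<not> n0 + 1 < N"
      then have "real (block_start \<beta> N) \<le> block_start \<beta> (n0+1)" by (simp add: block_start_mono)
      then have "\<alpha> * block_start \<beta> N \<le> \<alpha> * block_start \<beta> (n0+1)"
        using assms by (intro mult_left_mono) auto
      then show False using k N by linarith
    qed
    then obtain n where n: "N = n + 2" "n0 \<le> n" by (metis add_2_eq_Suc' add.commute less_iff_Suc_add le_add1 plus_1_eq_Suc add_Suc)
    have "\<not> k \<le> \<alpha> * block_start \<beta> (n+1)"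
      unfolding N_def using n by (intro not_less_Least) (simp flip: N_def)
    moreover from this have "e * block_start \<beta> (n+1) \<le> \<epsilon> * k"
      using \<open>0 < \<epsilon>\<close> by (simp add: e_def mult.assoc)
    ultimately show "\<exists>n. \<alpha> * block_start \<beta> (n+1) < real k \<and> real k \<le> \<alpha> * block_start \<beta> (n+2) \<and>
           fact n + B \<le> \<epsilon> * k"
      using N n small[of n] by (intro exI[of _ n]) auto
  qed
qed

section \<open>Packing dimension of the digit set\<close>

lemma digit_block_set_premeasure_eq_0:
  assumes "\<beta> < t"
  shows "packing_premeasure dist t (digit_set (block_set \<beta>)) = 0"
proof -
  \<comment> \<open>The digit count may exceed \<open>\<beta> * k\<close> by a small multiple of
    \<open>k\<close>; an exponent strictly between \<open>\<beta>\<close> and \<open>t\<close>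
    absorbs this.\<close>
  define s where "s = (\<beta> + t) / 2"
  have s: "\<beta> < s" "s < t" using assms by (auto simp: s_def)
  obtain K where K: "\<And>k::nat. K \<le> k \<Longrightarrow> \<exists>n. 1 * real (block_start \<beta> (n+1)) < real k \<and>
      real k \<le> 1 * real (block_start \<beta> (n+2)) \<and> fact n + 1 \<le> (s - \<beta>) * k"
    using block_scale[of 1 "s - \<beta>" 1] s by auto
  have count: "card (block_set \<beta> \<inter> {0<..k}) \<le> s * k" if "K \<le> k" for k
  proof -
    obtain n where n: "block_start \<beta> (n+1) < k" "k \<le> block_start \<beta> (n+2)" "fact n + 1 \<le> (s - \<beta>) * k"
      using K[OF \<open>K \<le> k\<close>] unfolding mult_1 of_nat_less_iff of_nat_le_iff by blast
    \<comment> \<open>Up to rounding, the current block contributes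
      \<open>X - (1 - \<beta>) * fact (n+1)\<close>, which is at most \<open>\<beta> * X\<close>
      because \<open>X \<le> fact (n+1)\<close>, hence at most \<open>\<beta> * k\<close>.\<close>
    define X where "X = min (fact (n+1)) k"
    have "block_start \<beta> (n+1) \<le> X" using n block_start_le_fact[of "n+1"] by (simp add: X_def)
    then have "real (card (block_set \<beta> \<inter> {0<..k})) \<le> real (fact n) + (real X - block_start \<beta> (n+1))"
      using card_block_set_le[OF n(2)] unfolding X_def[symmetric] by linarith
    moreover have "real X \<le> fact (n+1)" "real X \<le> k"
      unfolding X_def by (metis min.cobounded1 of_nat_fact of_nat_le_iff, simp)
    then have "(1 - \<beta>) * X \<le> (1 - \<beta>) * fact (n+1)" "\<beta> * X \<le> \<beta> * k"
      using \<beta> by (auto intro!: mult_left_mono simp del: fact_Suc)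
    ultimately show ?thesis
      using n block_start_bounds(2)[of "n+1"] by (simp add: algebra_simps)
  qed
  have "\<exists>\<phi>::real \<Rightarrow> nat. finite (\<phi> ` digit_set (block_set \<beta>)) \<and>
      card (\<phi> ` digit_set (block_set \<beta>)) \<le> 2 ^ card (block_set \<beta> \<inter> {0<..k}) \<and>
      (\<forall>x\<in>digit_set (block_set \<beta>). \<forall>y\<in>digit_set (block_set \<beta>). \<phi> x = \<phi> y \<longrightarrow> \<bar>x - y\<bar> \<le> 1 / 2^k)" for k
    by (rule digit_set_labels[of "block_set \<beta>" k]) blast
  then obtain \<phi> :: "nat \<Rightarrow> real \<Rightarrow> nat" where \<phi>: "\<And>k. finite (\<phi> k ` digit_set (block_set \<beta>))"
    "\<And>k. card (\<phi> k ` digit_set (block_set \<beta>)) \<le> 2 ^ card (block_set \<beta> \<inter> {0<..k})"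
    "\<And>k x y. x\<in>digit_set (block_set \<beta>) \<Longrightarrow> y\<in>digit_set (block_set \<beta>) \<Longrightarrow> \<phi> k x = \<phi> k y \<Longrightarrow> \<bar>x - y\<bar> \<le> 1 / 2^k"
    by metis
  show ?thesis
  proof (rule packing_premeasure_eq_0[of _ s t 1 1 K \<phi>])
    fix k assume "K \<le> k"
    have "real (card (\<phi> k ` digit_set (block_set \<beta>))) \<le> real (2 ^ card (block_set \<beta> \<inter> {0<..k}))"
      using \<phi>(2) of_nat_le_iff by blast
    also have "\<dots> = 2 powr card (block_set \<beta> \<inter> {0<..k})" by (simp add: powr_realpow)
    also have "\<dots> \<le> 2 powr (s * k)" using count[OF \<open>K \<le> k\<close>] by (intro powr_mono) auto
    finally show "real (card (\<phi> k ` digit_set (block_set \<beta>))) \<le> 1 * 2 powr (s * k)" by simp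
  qed (use s \<beta> \<phi> in \<open>auto simp: dist_real_def\<close>)
qed

lemma digit_block_set_measure_ge_1:
  assumes "0 \<le> s" "s < \<beta>"
  shows "1 \<le> packing_measure dist s (digit_set (block_set \<beta>))"
proof (rule packing_measure_ge_1)
  show "closed (digit_set (block_set \<beta>))" by (simp add: compact_digit_set compact_imp_closed)
  have "real 0 / 2^0 \<in> digit_set (block_set \<beta>)" by (rule dyadic_in_digit_set) simp
  then show "digit_set (block_set \<beta>) \<noteq> {}" by blast
  fix a e E assume "a \<in> digit_set (block_set \<beta>)" "(0::real) < e"
    "digit_set (block_set \<beta>) \<inter> ball a e \<subseteq> closure E"
  then show "1 \<le> packing_premeasure dist s E"
  proof (rule digit_set_premeasure_ge_1)
    fix m
    \<comment> \<open>The first bound puts block \<open>n\<close> beyond \<open>m\<close>; the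
      second is what \<open>s * (fact n + 1) \<le> \<beta> * fact n\<close> amounts to, as
      \<open>fact n\<close> is at least \<open>block_start \<beta> n\<close>.\<close>
    obtain n where n: "max (real m) (s / (\<beta> - s)) \<le> block_start \<beta> n" using block_start_unbounded by blast
    then have m: "m \<le> block_start \<beta> n" by simp
    have "s / (\<beta> - s) \<le> real (fact n)"
      using n block_start_le_fact[of n] by (meson max.boundedE of_nat_le_iff order_trans)
    then have "s * (real (fact n) + 1) \<le> \<beta> * fact n"
      using assms by (simp add: field_simps)
    then have "s * (real (fact n) + 1) \<le> card (block_set \<beta> \<inter> {m<..fact n})"
      using card_block_set_ge[OF m] by linarith
    moreover have "m \<le> fact n" using m block_start_le_fact[of n] by linarith
    ultimately show "\<exists>n\<ge>m. s * (real n + 1) \<le> card (block_set \<beta> \<inter> {m<..n})" by blast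
  qed
qed

lemma packing_dim_digit_block_set: "packing_dim dist (digit_set (block_set \<beta>)) = \<beta>"
proof (rule antisym)
  show "packing_dim dist (digit_set (block_set \<beta>)) \<le> \<beta>"
    using \<beta> digit_block_set_premeasure_eq_0 by (intro packing_dim_le) auto
next
  show "\<beta> \<le> packing_dim dist (digit_set (block_set \<beta>))"
    unfolding packing_dim_def
  proof (rule cInf_greatest)
    \<comment> \<open>Exponent 1 exceeds \<open>\<beta>\<close> and witnesses that the infimum is
      over a nonempty set.\<close>
    have "packing_measure dist 1 (digit_set (block_set \<beta>)) = 0"
      using \<beta> digit_block_set_premeasure_eq_0 by (intro packing_measure_eq_0) auto
    then show "{s. 0 \<le> s \<and> packing_measure dist s (digit_set (block_set \<beta>)) = 0} \<noteq> {}"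
      by (auto intro: exI[of _ 1])
  next
    fix s assume "s \<in> {s. 0 \<le> s \<and> packing_measure dist s (digit_set (block_set \<beta>)) = 0}"
    then show "\<beta> \<le> s" using digit_block_set_measure_ge_1[of s] by (cases "s < \<beta>") auto
  qed
qed

section \<open>Choosing the scale in the domain\<close>

text \<open>A finer domain scale \<open>y\<close> costs more digits but reduces the oscillation of
  the function over each interval. The three cases take \<open>y\<close> near
  \<open>k / \<alpha>\<close>, at the start of the block, or equal to \<open>k\<close>.\<close>

lemma block_exponent:
  fixes d :: nat and \<alpha> \<epsilon> s :: real
  assumes "1 \<le> d" "0 < \<alpha>" "\<alpha> < 1" "0 < \<epsilon>"
    and s: "\<beta> * d / (\<alpha> * d + \<beta> * (1 - \<alpha> * d)) \<le> s" "\<beta> * (d + 1 - \<alpha> * d) \<le> s"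
  shows "\<exists>K::nat. \<forall>k::nat. K \<le> k \<longrightarrow>
      (\<exists>y\<ge>k. card (block_set \<beta> \<inter> {0<..y}) + d * max 0 (k - \<alpha> * y) \<le> (s + \<epsilon>) * k)"
proof -
  obtain K where K: "\<And>k::nat. K \<le> k \<Longrightarrow> \<exists>n. \<alpha> * block_start \<beta> (n+1) < real k \<and>
      k \<le> \<alpha> * block_start \<beta> (n+2) \<and> fact n + (real d + 1) \<le> \<epsilon> * k"
    \<comment> \<open>The constant \<open>d + 1\<close> covers rounding: at most 1 in the digit
      count, or \<open>\<alpha> * d\<close> when \<open>y\<close> is the block start.\<close>
    using block_scale[of \<alpha> \<epsilon> "real d + 1"] assms by auto
  have "\<exists>y\<ge>k. card (block_set \<beta> \<inter> {0<..y}) + d * max 0 (k - \<alpha> * y) \<le> (s + \<epsilon>) * k"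
    if "K \<le> k" for k :: nat
  proof -
    obtain n where n: "\<alpha> * block_start \<beta> (n+1) < k" "k \<le> \<alpha> * block_start \<beta> (n+2)"
      "fact n + (real d + 1) \<le> \<epsilon> * k"
      using K[OF \<open>K \<le> k\<close>] by auto
    define L where "L = block_start \<beta> (n+1)"
    define X :: nat where "X = fact (n+1)"
    have X_real: "real X = fact (n+1)" unfolding X_def by (rule of_nat_fact)
    have L: "real L \<le> (1 - \<beta>) * X" "(1 - \<beta>) * X \<le> L + 1" "L \<le> X"
      using block_start_bounds[of "n+1"] block_start_le_fact[of "n+1"]
      by (simp_all add: L_def X_real X_def del: fact_Suc)
    have h: "real (card (block_set \<beta> \<inter> {0<..y})) \<le> fact n + real (min X y - L)"
      if "y \<le> block_start \<beta> (n+2)" for y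
      using card_block_set_le[OF that] unfolding L_def X_def
      by (metis of_nat_add of_nat_fact of_nat_le_iff)
    show ?thesis
    proof (cases "\<beta> * X \<le> s * k")
      case True
      \<comment> \<open>At this scale the oscillation term vanishes, and even the whole block costs
        only about \<open>\<beta> * X\<close>.\<close>
      define y where "y = nat \<lceil>k / \<alpha>\<rceil>"
      have "k / \<alpha> \<le> block_start \<beta> (n+2)" using n assms by (simp add: field_simps)
      then have 1: "y \<le> block_start \<beta> (n+2)" unfolding y_def by linarith
      have "k / \<alpha> \<le> y" unfolding y_def by linarith
      then have 2: "k \<le> \<alpha> * y" using assms by (simp add: field_simps)
      also have "\<dots> \<le> 1 * real y" using assms by (intro mult_right_mono) auto
      finally have 3: "k \<le> y" by simp
      have "real (min X y - L) \<le> X - L" using L by linarith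
      then show ?thesis
        using h[OF 1] 2 3 True L n by (intro exI[of _ y]) (simp add: algebra_simps)
    next
      case False
      then have sk: "s * k \<le> \<beta> * X" by simp
      \<comment> \<open>As \<open>(1 - \<beta>) * X\<close> is nearly \<open>L\<close>, this bounds
        the block start from below in terms of \<open>s * k\<close>.\<close>
      have sX: "(1 - \<beta>) * (s * k) \<le> \<beta> * ((1 - \<beta>) * X)"
        using mult_left_mono[OF sk, of "1 - \<beta>"] \<beta> by (simp add: algebra_simps)
      show ?thesis
      proof (cases "k \<le> L")
        case True
        \<comment> \<open>With \<open>y = L\<close> no digit of the block is used, so only the
          oscillation term matters. Clearing the denominator in the first bound on \<open>s\<close>
          and inserting \<open>sX\<close> controls it.\<close>
        have 1: "L \<le> block_start \<beta> (n+2)" unfolding L_def by (intro block_start_mono) simp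
        have pos: "0 < \<alpha> * d + \<beta> * (1 - \<alpha> * d)"
        proof -
          have "0 < (1 - \<beta>) * (\<alpha> * d) + \<beta>" using \<beta> assms by (intro add_nonneg_pos) auto
          then show ?thesis by (simp add: algebra_simps)
        qed
        have "\<beta> * d \<le> s * (\<alpha> * d + \<beta> * (1 - \<alpha> * d))"
          using s(1) pos by (simp add: pos_divide_le_eq)
        then have "\<beta> * d * k \<le> s * (\<alpha> * d + \<beta> * (1 - \<alpha> * d)) * k" by (intro mult_right_mono) auto
        then have "\<beta> * (d * k) \<le> \<alpha> * d * ((1 - \<beta>) * (s * k)) + \<beta> * (s * k)"
          by (simp add: algebra_simps)
        also have "\<alpha> * d * ((1 - \<beta>) * (s * k)) \<le> \<alpha> * d * (\<beta> * ((1 - \<beta>) * X))"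
          using sX assms by (intro mult_left_mono) auto
        finally have "\<beta> * (d * k) \<le> \<beta> * (\<alpha> * d * ((1 - \<beta>) * X) + s * k)"
          by (simp add: algebra_simps)
        then have "d * k \<le> \<alpha> * d * ((1 - \<beta>) * X) + s * k" using \<beta> by simp
        also have "\<alpha> * d * ((1 - \<beta>) * X) \<le> \<alpha> * d * (L + 1)"
          using L assms by (intro mult_left_mono) auto
        finally have "d * (k - \<alpha> * L) \<le> s * k + \<alpha> * d" by (simp add: algebra_simps)
        moreover have "\<alpha> * d \<le> 1 * real d" using assms by (intro mult_right_mono) auto
        moreover have "max 0 (k - \<alpha> * L) = k - \<alpha> * L" using n by (simp add: L_def)
        ultimately show ?thesis
          using h[OF 1] n True by (intro exI[of _ L]) (simp add: algebra_simps)
      next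
        case False
        have "real k \<le> block_start \<beta> (n+2)"
        proof -
          have "\<alpha> * block_start \<beta> (n+2) \<le> 1 * real (block_start \<beta> (n+2))"
            using assms by (intro mult_right_mono) auto
          then show ?thesis using n by simp
        qed
        then have 1: "k \<le> block_start \<beta> (n+2)" by simp
        have min: "real (min X k - L) \<le> real k - real L" using False by linarith
        \<comment> \<open>Splitting \<open>s * k\<close> as
          \<open>(1 - \<beta>) * (s * k) + \<beta> * (s * k)\<close> and applying \<open>sX\<close>
          to the first summand allows a division by \<open>\<beta>\<close>.\<close>
        have "\<beta> * (d + 1 - \<alpha> * d) * k \<le> s * k" using s(2) by (intro mult_right_mono) auto
        then have "\<beta> * ((d + 1 - \<alpha> * d) * k) \<le> \<beta> * ((1 - \<beta>) * X + s * k)"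
          using sX by (simp add: algebra_simps)
        then have "(d + 1 - \<alpha> * d) * k \<le> (1 - \<beta>) * X + s * k" using \<beta> by simp
        then have "card (block_set \<beta> \<inter> {0<..k}) + d * ((1 - \<alpha>) * k) \<le> (s + \<epsilon>) * k"
          using h[OF 1] min L n by (simp add: algebra_simps)
        moreover have "max 0 (k - \<alpha> * k) = (1 - \<alpha>) * k"
        proof -
          have "0 \<le> (1 - \<alpha>) * k" using assms by simp
          moreover have "k - \<alpha> * k = (1 - \<alpha>) * k" by (simp add: left_diff_distrib)
          ultimately show ?thesis by simp
        qed
        ultimately show ?thesis by (metis order_refl)
      qed
    qed
  qed
  then show ?thesis by blast
qed

end

section \<open>Covering graphs of Hoelder functions\<close>

text \<open>A graph point is labelled by the label of its parameter together with the grid cell of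
  side \<open>\<delta>\<close> containing its value. Over one parameter label each coordinate
  deviates from that of a fixed representative by at most \<open>C * \<rho> powr \<alpha>\<close>,
  which limits the cells that occur.\<close>

lemma holder_graph_labels:
  fixes \<phi> :: "real \<Rightarrow> 'b"
  assumes holder: "\<And>t u. t \<in> A \<Longrightarrow> u \<in> A \<Longrightarrow> euclid_dist d (f t) (f u) \<le> C * \<bar>t - u\<bar> powr \<alpha>"
    and "0 \<le> C" "0 \<le> \<alpha>" "0 < \<delta>"
    and fin: "finite (\<phi> ` A)"
    and \<phi>: "\<And>t u. t \<in> A \<Longrightarrow> u \<in> A \<Longrightarrow> \<phi> t = \<phi> u \<Longrightarrow> \<bar>t - u\<bar> \<le> \<rho>" and "\<rho> \<le> \<delta>"
  obtains \<psi> :: "(nat \<Rightarrow> real) \<Rightarrow> 'b \<times> (nat \<Rightarrow> int)" where "finite (\<psi> ` graph_map f ` A)"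
    and "card (\<psi> ` graph_map f ` A) \<le> card (\<phi> ` A) * (2 * C * \<rho> powr \<alpha> / \<delta> + 2) ^ d"
    and "\<And>x y. x \<in> graph_map f ` A \<Longrightarrow> y \<in> graph_map f ` A \<Longrightarrow> \<psi> x = \<psi> y \<Longrightarrow>
           euclid_dist (d+1) x y \<le> (real d + 1) * \<delta>"
proof -
  define w where "w = C * \<rho> powr \<alpha> / \<delta>"
  \<comment> \<open>Restricting to \<open>{..<d}\<close> discards the coordinates that
    \<open>euclid_dist d\<close> ignores and keeps the set of labels finite.\<close>
  define F where "F = (\<lambda>t. \<lambda>i\<in>{..<d}. \<lfloor>f t i / \<delta>\<rfloor>)"
  define G where "G = (\<lambda>t. (\<phi> t, F t))"
  define rep where "rep = inv_into A \<phi>"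
  have rep: "rep l \<in> A \<and> \<phi> (rep l) = l" if "l \<in> \<phi> ` A" for l
    using that by (simp add: rep_def inv_into_into f_inv_into_f)
  define R where "R = (\<lambda>l. PiE {..<d} (\<lambda>i. {\<lfloor>f (rep l) i / \<delta> - w\<rfloor>..\<lfloor>f (rep l) i / \<delta> + w\<rfloor>}))"
  have coord: "\<bar>f t i / \<delta> - f u i / \<delta>\<bar> \<le> w"
    if "t \<in> A" "u \<in> A" "\<phi> t = \<phi> u" "i < d" for t u i
  proof -
    have "\<bar>f t i - f u i\<bar> \<le> euclid_dist d (f t) (f u)"
      unfolding euclid_dist_def
      using that member_le_L2_set[of "{..<d}" i "\<lambda>i. \<bar>f t i - f u i\<bar>"] by (simp add: L2_set_def)
    also have "\<dots> \<le> C * \<bar>t - u\<bar> powr \<alpha>" using holder that by blast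
    also have "\<dots> \<le> C * \<rho> powr \<alpha>"
      using \<phi>[of t u] that \<open>0 \<le> C\<close> \<open>0 \<le> \<alpha>\<close> by (intro mult_left_mono powr_mono2) auto
    finally show ?thesis
      using \<open>0 < \<delta>\<close> by (simp add: w_def divide_right_mono flip: diff_divide_distrib)
  qed
  have sub: "G ` A \<subseteq> Sigma (\<phi> ` A) R"
  proof (clarsimp simp: G_def)
    fix t assume "t \<in> A"
    have "f (rep (\<phi> t)) i / \<delta> - w \<le> f t i / \<delta> \<and> f t i / \<delta> \<le> f (rep (\<phi> t)) i / \<delta> + w" if "i < d" for i
      using coord[of t "rep (\<phi> t)" i] rep[of "\<phi> t"] \<open>t \<in> A\<close> that by (auto simp: abs_le_iff)
    then show "F t \<in> R (\<phi> t)"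
      by (auto simp: F_def R_def intro!: floor_mono)
  qed
  have finR: "finite (R l)" for l
    unfolding R_def by (intro finite_PiE) auto
  have fin_Sigma: "finite (Sigma (\<phi> ` A) R)"
    using fin finR by (intro finite_SigmaI) auto
  have card_R: "card (R l) \<le> (2 * w + 2) ^ d" if "l \<in> \<phi> ` A" for l
  proof -
    have "real (card (R l)) = (\<Prod>i<d. real (nat (\<lfloor>f (rep l) i / \<delta> + w\<rfloor> - \<lfloor>f (rep l) i / \<delta> - w\<rfloor> + 1)))"
      unfolding R_def by (simp add: card_PiE)
    also have "\<dots> \<le> (\<Prod>i<d. 2 * w + 2)"
    proof (intro prod_mono conjI)
      have "0 \<le> w" using \<open>0 \<le> C\<close> \<open>0 < \<delta>\<close> by (simp add: w_def)
      then show "real (nat (\<lfloor>f (rep l) i / \<delta> + w\<rfloor> - \<lfloor>f (rep l) i / \<delta> - w\<rfloor> + 1)) \<le> 2 * w + 2" for i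
        by linarith
    qed auto
    finally show ?thesis by simp
  qed
  have "real (card (G ` A)) \<le> real (card (Sigma (\<phi> ` A) R))"
    using card_mono[OF fin_Sigma sub] by simp
  also have "\<dots> = (\<Sum>l\<in>\<phi> ` A. real (card (R l)))"
    using fin finR by (simp add: card_SigmaI)
  also have "\<dots> \<le> card (\<phi> ` A) * (2 * w + 2) ^ d"
    by (intro sum_bounded_above card_R)
  finally have card_G: "card (G ` A) \<le> card (\<phi> ` A) * (2 * w + 2) ^ d" .
  \<comment> \<open>Coordinate 0 of a graph point is its parameter, so labels of parameters become
    labels of graph points.\<close>
  have img: "(\<lambda>x. G (x 0)) ` graph_map f ` A = G ` A"
    by (simp add: image_image graph_map_def)
  show ?thesis
  proof (rule that[of "\<lambda>x. G (x 0)"])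
    show "finite ((\<lambda>x. G (x 0)) ` graph_map f ` A)"
      unfolding img using finite_subset[OF sub fin_Sigma] .
    show "card ((\<lambda>x. G (x 0)) ` graph_map f ` A) \<le> card (\<phi> ` A) * (2 * C * \<rho> powr \<alpha> / \<delta> + 2) ^ d"
      unfolding img using card_G by (simp add: w_def mult.assoc)
    fix x y assume "x \<in> graph_map f ` A" "y \<in> graph_map f ` A" "G (x 0) = G (y 0)"
    then obtain t u where tu: "t \<in> A" "u \<in> A" "G t = G u" and x: "x = graph_map f t" and y: "y = graph_map f u"
      by (auto simp: graph_map_def)
    have diff: "\<bar>x i - y i\<bar> \<le> \<delta>" if "i < d + 1" for i
    proof (cases i)
      case 0
      then show ?thesis using \<phi>[of t u] tu \<open>\<rho> \<le> \<delta>\<close> by (simp add: x y graph_map_def G_def)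
    next
      case (Suc j)
      then have "F t j = F u j" "j < d" using tu that by (auto simp: G_def)
      then have "\<lfloor>f t j / \<delta>\<rfloor> = \<lfloor>f u j / \<delta>\<rfloor>" by (simp add: F_def)
      then have "\<bar>f t j / \<delta> - f u j / \<delta>\<bar> \<le> 1" by linarith
      then have "\<bar>f t j - f u j\<bar> \<le> \<delta>"
        using \<open>0 < \<delta>\<close> by (simp flip: diff_divide_distrib)
      then show ?thesis by (simp add: x y graph_map_def Suc)
    qed
    \<comment> \<open>The Euclidean norm is at most the sum of the \<open>d + 1\<close> coordinate
      differences.\<close>
    have "euclid_dist (d+1) x y \<le> (\<Sum>i<d+1. \<bar>x i - y i\<bar>)"
      using L2_set_le_sum_abs[of "\<lambda>i. x i - y i" "{..<d+1}"] by (simp add: euclid_dist_def L2_set_def)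
    also have "\<dots> \<le> real (card {..<d+1}) * \<delta>"
      using diff by (intro sum_bounded_above) auto
    finally show "euclid_dist (d+1) x y \<le> (real d + 1) * \<delta>" by (simp add: add.commute)
  qed
qed

lemma holder_graph_premeasure_eq_0:
  fixes d :: nat and \<alpha> \<beta> s t :: real
  assumes \<beta>: "0 < \<beta>" "\<beta> < 1" and d: "1 \<le> d" and \<alpha>: "0 < \<alpha>" "\<alpha> < 1"
    and holder: "holder_on d \<alpha> (digit_set (block_set \<beta>)) f"
    and s: "\<beta> * d / (\<alpha> * d + \<beta> * (1 - \<alpha> * d)) \<le> s" "\<beta> * (d + 1 - \<alpha> * d) \<le> s"
    and t: "s < t" "0 \<le> t"
  shows "packing_premeasure (euclid_dist (d+1)) t (graph_map f ` digit_set (block_set \<beta>)) = 0"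
proof -
  let ?S = "block_set \<beta>"
  let ?A = "digit_set ?S"
  define \<epsilon> where "\<epsilon> = (t - s) / 2"
  obtain K :: nat where K: "\<And>k::nat. K \<le> k \<Longrightarrow>
      \<exists>y\<ge>k. card (?S \<inter> {0<..y}) + d * max 0 (k - \<alpha> * y) \<le> (s + \<epsilon>) * k"
    using block_exponent[OF \<beta> d \<alpha> _ s, of \<epsilon>] t by (auto simp: \<epsilon>_def)
  obtain C0 where C0: "\<And>x y. x \<in> ?A \<Longrightarrow> y \<in> ?A \<Longrightarrow> euclid_dist d (f x) (f y) \<le> C0 * \<bar>x - y\<bar> powr \<alpha>"
    using holder by (auto simp: holder_on_def)
  \<comment> \<open>The definition of \<open>holder_on\<close> admits a negative constant, hence the
    truncation at 0.\<close>
  define C where "C = max C0 0"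
  have "0 \<le> C" by (simp add: C_def)
  have C: "euclid_dist d (f x) (f y) \<le> C * \<bar>x - y\<bar> powr \<alpha>" if "x \<in> ?A" "y \<in> ?A" for x y
    using C0[OF that] mult_right_mono[of C0 C "\<bar>x - y\<bar> powr \<alpha>"] by (auto simp: C_def)
  have "\<exists>\<psi>::(nat \<Rightarrow> real) \<Rightarrow> nat \<times> (nat \<Rightarrow> int). K \<le> k \<longrightarrow>
      finite (\<psi> ` graph_map f ` ?A) \<and>
      card (\<psi> ` graph_map f ` ?A) \<le> (2 * C + 2) ^ d * 2 powr ((s + \<epsilon>) * k) \<and>
      (\<forall>x\<in>graph_map f ` ?A. \<forall>y\<in>graph_map f ` ?A. \<psi> x = \<psi> y \<longrightarrow>
         euclid_dist (d+1) x y \<le> (real d + 1) / 2^k)" for k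
  proof (cases "K \<le> k")
    case True
    then obtain y where y: "k \<le> y" "card (?S \<inter> {0<..y}) + d * max 0 (k - \<alpha> * y) \<le> (s + \<epsilon>) * k"
      using K by blast
    obtain \<phi> :: "real \<Rightarrow> nat" where fin: "finite (\<phi> ` ?A)"
      and card: "card (\<phi> ` ?A) \<le> 2 ^ card (?S \<inter> {0<..y})"
      and \<phi>: "\<And>u v. u \<in> ?A \<Longrightarrow> v \<in> ?A \<Longrightarrow> \<phi> u = \<phi> v \<Longrightarrow> \<bar>u - v\<bar> \<le> 1 / 2^y"
      using digit_set_labels[of ?S y] by blast
    have "(1::real) / 2^y \<le> 1 / 2^k" using y by (simp add: field_simps)
    then obtain \<psi> :: "(nat \<Rightarrow> real) \<Rightarrow> nat \<times> (nat \<Rightarrow> int)" where \<psi>: "finite (\<psi> ` graph_map f ` ?A)"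
      "card (\<psi> ` graph_map f ` ?A) \<le> card (\<phi> ` ?A) * (2 * C * (1/2^y) powr \<alpha> / (1/2^k) + 2) ^ d"
      "\<And>x y. x \<in> graph_map f ` ?A \<Longrightarrow> y \<in> graph_map f ` ?A \<Longrightarrow> \<psi> x = \<psi> y \<Longrightarrow>
           euclid_dist (d+1) x y \<le> (real d + 1) * (1/2^k)"
      using holder_graph_labels[of ?A d f C \<alpha> "1/2^k" \<phi> "1/2^y"] C \<open>0 \<le> C\<close> \<alpha> fin \<phi> by auto
    \<comment> \<open>In units of \<open>2^-k\<close> the oscillation over an interval of length
      \<open>2^-y\<close> is at most \<open>C * 2 powr M\<close>; since \<open>M\<close> is
      nonnegative, the summand 2 is absorbed into the factor \<open>2 * C + 2\<close>.\<close>
    define M where "M = max 0 (k - \<alpha> * y)"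
    have "(1/2^y::real) = 2 powr (- real y)" by (simp add: powr_minus_divide powr_realpow)
    then have "(1/2^y::real) powr \<alpha> = 2 powr (- (\<alpha> * y))"
      by (metis mult.commute mult_minus_right powr_powr)
    then have "(1/2^y::real) powr \<alpha> / (1/2^k) = 2 powr (- (\<alpha> * y)) * 2 powr k"
      by (simp add: powr_realpow)
    then have "(1/2^y::real) powr \<alpha> / (1/2^k) = 2 powr (k - \<alpha> * y)"
      by (simp flip: powr_add)
    also have "\<dots> \<le> 2 powr M" by (simp add: M_def)
    finally have "C * ((1/2^y) powr \<alpha> / (1/2^k)) \<le> C * 2 powr M"
      using \<open>0 \<le> C\<close> by (intro mult_left_mono)
    moreover have "(1::real) \<le> 2 powr M" by (intro ge_one_powr_ge_zero) (auto simp: M_def)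
    ultimately have "2 * C * (1/2^y) powr \<alpha> / (1/2^k) + 2 \<le> (2 * C + 2) * 2 powr M"
      by (simp add: algebra_simps)
    then have "(2 * C * (1/2^y) powr \<alpha> / (1/2^k) + 2) ^ d \<le> ((2 * C + 2) * 2 powr M) ^ d"
      using \<open>0 \<le> C\<close> by (intro power_mono) auto
    also have "\<dots> = (2 * C + 2) ^ d * 2 powr (d * M)"
      by (simp add: power_mult_distrib powr_powr mult.commute flip: powr_realpow)
    finally have pow: "(2 * C * (1/2^y) powr \<alpha> / (1/2^k) + 2) ^ d \<le> (2 * C + 2) ^ d * 2 powr (d * M)" .
    have "real (card (\<phi> ` ?A)) \<le> real (2 ^ card (?S \<inter> {0<..y}))"
      using card of_nat_le_iff by blast
    then have "real (card (\<phi> ` ?A)) \<le> 2 powr card (?S \<inter> {0<..y})"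
      by (simp add: powr_realpow)
    then have "card (\<phi> ` ?A) * (2 * C * (1/2^y) powr \<alpha> / (1/2^k) + 2) ^ d
        \<le> 2 powr card (?S \<inter> {0<..y}) * ((2 * C + 2) ^ d * 2 powr (d * M))"
      using pow \<open>0 \<le> C\<close> by (intro mult_mono) auto
    also have "\<dots> = (2 * C + 2) ^ d * 2 powr (card (?S \<inter> {0<..y}) + d * M)"
      by (simp add: powr_add)
    also have "\<dots> \<le> (2 * C + 2) ^ d * 2 powr ((s + \<epsilon>) * k)"
      using y \<open>0 \<le> C\<close> by (intro mult_left_mono powr_mono) (auto simp: M_def)
    finally have "card (\<psi> ` graph_map f ` ?A) \<le> (2 * C + 2) ^ d * 2 powr ((s + \<epsilon>) * k)"
      using \<psi>(2) by linarith
    then show ?thesis using \<psi>(1,3) by (intro exI[of _ \<psi>]) auto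
  qed auto
  then obtain \<psi> :: "nat \<Rightarrow> (nat \<Rightarrow> real) \<Rightarrow> nat \<times> (nat \<Rightarrow> int)" where \<psi>: "\<And>k. K \<le> k \<Longrightarrow>
      finite (\<psi> k ` graph_map f ` ?A) \<and>
      card (\<psi> k ` graph_map f ` ?A) \<le> (2 * C + 2) ^ d * 2 powr ((s + \<epsilon>) * k) \<and>
      (\<forall>x\<in>graph_map f ` ?A. \<forall>y\<in>graph_map f ` ?A. \<psi> k x = \<psi> k y \<longrightarrow>
         euclid_dist (d+1) x y \<le> (real d + 1) / 2^k)"
    by metis
  show ?thesis
  proof (rule packing_premeasure_eq_0[of _ "s + \<epsilon>" t "real d + 1" "(2 * C + 2) ^ d" K \<psi>])
    show "euclid_dist (d+1) x x = 0" for x by (simp add: euclid_dist_def)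
    show "s + \<epsilon> < t" using t by (simp add: \<epsilon>_def field_simps)
  qed (use t \<psi> \<open>0 \<le> C\<close> in auto)
qed

theorem theorem1p16:
  fixes \<beta> :: real
  assumes "0 < \<beta>" and "\<beta> < 1"
  shows "\<exists>A::real set. compact A \<and> A \<subseteq> {0..1} \<and> packing_dim dist A = \<beta> \<and>
    (\<forall>(d::nat) (\<alpha>::real) (f::real \<Rightarrow> nat \<Rightarrow> real).
       d \<ge> 1 \<and> 0 < \<alpha> \<and> \<alpha> < 1 \<and> holder_on d \<alpha> A f \<longrightarrow>
       packing_dim (euclid_dist (d+1)) (graph_map f ` A)
         \<le> max (\<beta> * d / (\<alpha> * d + \<beta> * (1 - \<alpha> * d))) (\<beta> * (d + 1 - \<alpha> * d)))"
proof (intro exI[of _ "digit_set (block_set \<beta>)"] conjI allI impI)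
  show "compact (digit_set (block_set \<beta>))" by (rule compact_digit_set)
  show "digit_set (block_set \<beta>) \<subseteq> {0..1}" by (rule digit_set_subset)
  show "packing_dim dist (digit_set (block_set \<beta>)) = \<beta>"
    using assms by (rule packing_dim_digit_block_set)
next
  fix d :: nat and \<alpha> :: real and f :: "real \<Rightarrow> nat \<Rightarrow> real"
  assume A: "d \<ge> 1 \<and> 0 < \<alpha> \<and> \<alpha> < 1 \<and> holder_on d \<alpha> (digit_set (block_set \<beta>)) f"
  define s where "s = max (\<beta> * d / (\<alpha> * d + \<beta> * (1 - \<alpha> * d))) (\<beta> * (d + 1 - \<alpha> * d))"
  \<comment> \<open>\<open>packing_dim\<close> ranges over nonnegative exponents; the second term of
    the maximum shows that \<open>s\<close> is one.\<close>
  have "\<alpha> * d \<le> 1 * real d" using A by (intro mult_right_mono) auto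
  then have "0 \<le> \<beta> * (d + 1 - \<alpha> * d)" using assms by simp
  then have "0 \<le> s" by (simp add: s_def)
  moreover have "packing_premeasure (euclid_dist (d+1)) t (graph_map f ` digit_set (block_set \<beta>)) = 0"
    if "s < t" for t
    by (rule holder_graph_premeasure_eq_0[of \<beta> d \<alpha> f s t])
      (use assms A that \<open>0 \<le> s\<close> in \<open>auto simp: s_def\<close>)
  ultimately have "packing_dim (euclid_dist (d+1)) (graph_map f ` digit_set (block_set \<beta>)) \<le> s"
    by (rule packing_dim_le)
  then show "packing_dim (euclid_dist (d+1)) (graph_map f ` digit_set (block_set \<beta>))
         \<le> max (\<beta> * d / (\<alpha> * d + \<beta> * (1 - \<alpha> * d))) (\<beta> * (d + 1 - \<alpha> * d))"
    unfolding s_def .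
qed

end
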